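(* Let $h$ be a strict CBF of $\mathcal{C}$ (with associated extended class $\mathcal{K}_\infty$ function $\alpha$) and suppose $h(\mathbf{0}_n)>0$. Let $\mathbf{x}_*\in\mathbb{R}^n$ be such that $\tilde f(\mathbf{x}_* )\neq \mathbf{0}_n$. Then $\mathbf{x}_*$ is an equilibrium of the filtered system $\dot{\mathbf{x}}=\tilde f(\mathbf{x})+g(\mathbf{x})v(\mathbf{x})$ if and only if there exists $\delta<0$ such that $$h(\mathbf{x}_* )=0\quad\text{and}\quad \tilde f(\mathbf{x}_* )=\delta\, g(\mathbf{x}_* )G(\mathbf{x}_* )^{-1}g(\mathbf{x}_* )^\top\nabla h(\mathbf{x}_* ).$$ Moreover, whether $\mathbf{x}_*$ is an equilibrium of the filtered system is independent of the choice of $h$ and $\alpha$: if $\mathbf{x}_*$ is an equilibrium of the filtered system built from $(h,\alpha)$, then it is also an equilibrium of the filtered system built from any other strict CBF of the same set $\mathcal{C}$ and its associated extended class $\mathcal{K}_\infty$ function.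
   Context: Setting. $f:\mathbb{R}^n\to\mathbb{R}^n$, $g:\mathbb{R}^n\to\mathbb{R}^{n\times m}$ are locally Lipschitz and define the control-affine system $\dot{\mathbf{x}}=f(\mathbf{x})+g(\mathbf{x})\mathbf{u}$. A locally Lipschitz nominal controller $k:\mathbb{R}^n\to\mathbb{R}^m$ is given such that $\dot{\mathbf{x}}=\tilde f(\mathbf{x}):=f(\mathbf{x})+g(\mathbf{x})k(\mathbf{x})$ has the origin as its unique equilibrium, which is globally asymptotically stable. A function $\alpha:\mathbb{R}\to\mathbb{R}$ is of extended class $\mathcal{K}_\infty$ if it is (continuous and) strictly increasing, $\alpha(0)=0$ and $\lim_{s\to\pm\infty}\alpha(s)=\pm\infty$. Let $\mathcal{C}\subset\mathbb{R}^n$ and let $h:\mathbb{R}^n\to\mathbb{R}$ be continuously differentiable with $\mathcal{C}=\{h\ge 0\}$ and $\partial\mathcal{C}=\{h=0\}$. $h$ is a strict control barrier function (strict CBF) of $\mathcal{C}$ if there is an extended class $\mathcal{K}_\infty$ function $\alpha$ such that for every $\mathbf{x}\in\mathcal{C}$ there is $\mathbf{u}\in\mathbb{R}^m$ with $\nabla h(\mathbf{x})^\top(f(\mathbf{x})+g(\mathbf{x})\mathbf{u})+\alpha(h(\mathbf{x}))>0$. Filtered system: $\dot{\mathbf{x}}=\tilde f(\mathbf{x})+g(\mathbf{x})v(\mathbf{x})$, where the safety filter $v(\mathbf{x})$ is the unique minimizer of $\boldsymbol\theta^\top G(\mathbf{x})\boldsymbol\theta$ over $\boldsymbol\theta\in\mathbb{R}^m$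 subject to $\nabla h(\mathbf{x})^\top(\tilde f(\mathbf{x})+g(\mathbf{x})\boldsymbol\theta)+\alpha(h(\mathbf{x}))\ge 0$; here $G:\mathbb{R}^n\to\mathbb{R}^{m\times m}$ is continuously differentiable with $G(\mathbf{x})$ positive definite for all $\mathbf{x}$, and $\alpha$ is the function associated with $h$. With $\eta(\mathbf{x})=\nabla h(\mathbf{x})^\top\tilde f(\mathbf{x})+\alpha(h(\mathbf{x}))$ one has, for $\mathbf{x}\in\mathcal{C}$, $v(\mathbf{x})=\mathbf{0}_m$ if $\eta(\mathbf{x})\ge0$ and $v(\mathbf{x})=-\dfrac{\eta(\mathbf{x})G(\mathbf{x})^{-1}g(\mathbf{x})^\top\nabla h(\mathbf{x})}{\nabla h(\mathbf{x})^\top g(\mathbf{x})G(\mathbf{x})^{-1}g(\mathbf{x})^\top\nabla h(\mathbf{x})}$ if $\eta(\mathbf{x})<0$; $v$ is well defined and locally Lipschitz on $\mathcal{C}$, and $\mathcal{C}$ is forward invariant. The filtered system is studied on $\mathcal{C}$. *)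

theory Defs
  imports "HOL-Analysis.Analysis"
begin

section \<open>Regularity\<close>

text \<open>An autonomous map is a time-dependent one that ignores its first argument.\<close>
abbreviation locally_lipschitz :: "('a::metric_space \<Rightarrow> 'b::metric_space) \<Rightarrow> bool" where
  "locally_lipschitz F \<equiv> local_lipschitz UNIV UNIV (\<lambda>_::real. F)"

definition continuously_differentiable ::
    "('a::real_normed_vector \<Rightarrow> 'b::real_normed_vector) \<Rightarrow> bool" where
  "continuously_differentiable F \<longleftrightarrow>
     (\<exists>F' :: 'a \<Rightarrow> 'a \<Rightarrow>\<^sub>L 'b.
        (\<forall>x. (F has_derivative blinfun_apply (F' x)) (at x)) \<and> continuous_on UNIV F')"

definition grad :: "(real^'n \<Rightarrow> real) \<Rightarrow> real^'n \<Rightarrow> real^'n" where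
  "grad h x = (THE D. GDERIV h x :> D)"

lemma grad_eqI:
  assumes "GDERIV h x :> D"
  shows "grad h x = D"
  unfolding grad_def
proof (rule the_equality)
  show "GDERIV h x :> D" by fact
  fix E assume "GDERIV h x :> E"
  then have "(\<lambda>y. y \<bullet> E) = (\<lambda>y. y \<bullet> D)"
    using assms unfolding gderiv_def by (rule has_derivative_unique)
  then have "(E - D) \<bullet> E = (E - D) \<bullet> D" by (rule fun_cong)
  then have "(E - D) \<bullet> (E - D) = 0" by (simp add: inner_diff_right)
  then show "E = D" by simp
qed

text \<open>As usual, positive definiteness includes symmetry.\<close>
definition positive_definite :: "real^'m^'m \<Rightarrow> bool" where
  "positive_definite A \<longleftrightarrow> transpose A = A \<and> (\<forall>z. z \<noteq> 0 \<longrightarrow> z \<bullet> (A *v z) > 0)"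

definition ext_class_K_infinity :: "(real \<Rightarrow> real) \<Rightarrow> bool" where
  "ext_class_K_infinity \<alpha> \<longleftrightarrow>
     continuous_on UNIV \<alpha> \<and> strict_mono \<alpha> \<and> \<alpha> 0 = 0 \<and>
     filterlim \<alpha> at_top at_top \<and> filterlim \<alpha> at_bot at_bot"


section \<open>Autonomous systems\<close>

definition equilibrium_in :: "'a::real_normed_vector set \<Rightarrow> ('a \<Rightarrow> 'a) \<Rightarrow> 'a \<Rightarrow> bool" where
  "equilibrium_in S F x \<longleftrightarrow> x \<in> S \<and> F x = 0"

definition forward_solution :: "('a::real_normed_vector \<Rightarrow> 'a) \<Rightarrow> (real \<Rightarrow> 'a) \<Rightarrow> bool" where
  "forward_solution F \<phi> \<longleftrightarrow>
     (\<forall>t\<ge>0. (\<phi> has_vector_derivative F (\<phi> t)) (at t within {0..}))"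

text \<open>The conjuncts are forward completeness, Lyapunov stability of the origin and its
  global attractivity.\<close>
definition origin_GAS :: "('a::real_normed_vector \<Rightarrow> 'a) \<Rightarrow> bool" where
  "origin_GAS F \<longleftrightarrow>
     (\<forall>x. \<exists>\<phi>. forward_solution F \<phi> \<and> \<phi> 0 = x) \<and>
     (\<forall>\<epsilon>>0. \<exists>\<delta>>0. \<forall>\<phi>. forward_solution F \<phi> \<and> norm (\<phi> 0) < \<delta> \<longrightarrow>
        (\<forall>t\<ge>0. norm (\<phi> t) < \<epsilon>)) \<and>
     (\<forall>\<phi>. forward_solution F \<phi> \<longrightarrow> (\<phi> \<longlongrightarrow> 0) at_top)"


section \<open>Control barrier functions and safety filters\<close>

definition closed_loop ::
    "(real^'n \<Rightarrow> real^'n) \<Rightarrow> (real^'n \<Rightarrow> real^'m^'n) \<Rightarrow> (real^'n \<Rightarrow> real^'m) \<Rightarrow> real^'n \<Rightarrow> real^'n" where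
  "closed_loop f g w x = f x + g x *v w x"

text \<open>\<open>h\<close> is a strict CBF of \<open>C\<close>, with \<open>\<alpha>\<close> an associated extended class K-infinity function.\<close>
definition strict_CBF ::
    "(real^'n \<Rightarrow> real^'n) \<Rightarrow> (real^'n \<Rightarrow> real^'m^'n) \<Rightarrow> (real^'n) set \<Rightarrow>
     (real^'n \<Rightarrow> real) \<Rightarrow> (real \<Rightarrow> real) \<Rightarrow> bool" where
  "strict_CBF f g C h \<alpha> \<longleftrightarrow>
     continuously_differentiable h \<and>
     C = {x. h x \<ge> 0} \<and> frontier C = {x. h x = 0} \<and>
     ext_class_K_infinity \<alpha> \<and>
     (\<forall>x\<in>C. \<exists>u. grad h x \<bullet> (f x + g x *v u) + \<alpha> (h x) > 0)"

text \<open>The parameter \<open>F\<close> is the nominal vector field. The minimizer exists and is unique whenever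
  \<open>G x\<close> is positive definite and the constraint is feasible at \<open>x\<close>, in particular on \<open>C\<close>
  for a strict CBF of \<open>C\<close>; elsewhere the value is unspecified.\<close>
definition safety_filter ::
    "(real^'n \<Rightarrow> real^'n) \<Rightarrow> (real^'n \<Rightarrow> real^'m^'n) \<Rightarrow> (real^'n \<Rightarrow> real^'m^'m) \<Rightarrow>
     (real^'n \<Rightarrow> real) \<Rightarrow> (real \<Rightarrow> real) \<Rightarrow> real^'n \<Rightarrow> real^'m" where
  "safety_filter F g G h \<alpha> x =
     (THE \<theta>. is_arg_min (\<lambda>\<theta>. \<theta> \<bullet> (G x *v \<theta>))
                (\<lambda>\<theta>. grad h x \<bullet> (F x + g x *v \<theta>) + \<alpha> (h x) \<ge> 0) \<theta>)"

definition filtered_system ::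
    "(real^'n \<Rightarrow> real^'n) \<Rightarrow> (real^'n \<Rightarrow> real^'m^'n) \<Rightarrow> (real^'n \<Rightarrow> real^'m) \<Rightarrow>
     (real^'n \<Rightarrow> real^'m^'m) \<Rightarrow> (real^'n \<Rightarrow> real) \<Rightarrow> (real \<Rightarrow> real) \<Rightarrow> real^'n \<Rightarrow> real^'n" where
  "filtered_system f g k G h \<alpha> =
     closed_loop (closed_loop f g k) g (safety_filter (closed_loop f g k) g G h \<alpha>)"

end

(* The Karush-Kuhn-Tucker conditions characterize the minimizer of the filter's quadratic program,
   with multiplier l for the single constraint. At an equilibrium F + g v = 0 the constraint reads
   alpha (h x) >= 0, and l > 0 because otherwise v = 0 and F = 0; complementary slackness then
   forces alpha (h x) = 0, so h x = 0 and F is -l times g G^-1 g^T grad h. Independence of (h, alpha):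
   at a boundary point strictness makes the gradients of two barrier functions of the same set
   nonzero, hence positive multiples of each other, which merely rescales delta. *)

theory Submission
  imports Defs
begin

section \<open>Positive definite matrices\<close>

lemma positive_definite_invertible:
  assumes "positive_definite A"
  shows "invertible A"
proof -
  have "z = 0" if "A *v z = 0" for z
    using assms that unfolding positive_definite_def by force
  then show ?thesis
    by (simp add: invertible_left_inverse matrix_left_invertible_ker)
qed

lemma positive_definite_solve_iff:
  assumes "positive_definite A"
  shows "A *v z = b \<longleftrightarrow> z = matrix_inv A *v b"
proof -
  \<comment> \<open>\<open>matrix_inv\<close> is a Hilbert choice; invertibility makes the chosen
    matrix a two-sided inverse.\<close>
  have "A ** matrix_inv A = mat 1 \<and> matrix_inv A ** A = mat 1"
    using positive_definite_invertible[OF assms] unfolding invertible_def matrix_inv_def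
    by (rule someI_ex)
  then show ?thesis
    by (metis matrix_vector_mul_assoc matrix_vector_mul_lid)
qed

text \<open>With \<open>w = matrix_inv A *v b\<close>, the claimed quantity is the quadratic form of
  \<open>A\<close> at the nonzero vector \<open>w\<close>.\<close>

lemma positive_definite_inner_inverse_pos:
  assumes "positive_definite A" and "b \<noteq> 0"
  shows "b \<bullet> (matrix_inv A *v b) > 0"
proof -
  define w where "w = matrix_inv A *v b"
  have Aw: "A *v w = b"
    using positive_definite_solve_iff[OF assms(1)] w_def by blast
  with assms(2) have "w \<noteq> 0"
    by (metis matrix_vector_mult_0_right)
  with assms(1) have "w \<bullet> (A *v w) > 0"
    by (simp add: positive_definite_def)
  then show ?thesis
    by (simp add: Aw w_def[symmetric] inner_commute)
qed

section \<open>Quadratic programs with one affine constraint\<close>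

lemma quadratic_form_expand:
  assumes "transpose A = (A :: real^'m^'m)"
  shows "y \<bullet> (A *v y) = x \<bullet> (A *v x) + 2 * ((y - x) \<bullet> (A *v x)) + (y - x) \<bullet> (A *v (y - x))"
proof -
  \<comment> \<open>Symmetry of \<open>A\<close> merges the two cross terms.\<close>
  have "x \<bullet> (A *v y) = y \<bullet> (A *v x)"
    by (metis assms dot_lmul_matrix inner_commute transpose_matrix_vector)
  then show ?thesis
    by (simp add: matrix_vector_mult_diff_distrib inner_diff_left inner_diff_right)
qed

text \<open>The program is to minimize \<open>x \<bullet> (A *v x)\<close> subject to \<open>b \<bullet> x + c \<ge> 0\<close>; the factor \<open>2\<close> of
  the gradient is absorbed in the multiplier \<open>l\<close>.\<close>
definition KKT :: "real^'m^'m \<Rightarrow> real^'m \<Rightarrow> real \<Rightarrow> real \<Rightarrow> real^'m \<Rightarrow> bool" where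
  "KKT A b c l x \<longleftrightarrow> l \<ge> 0 \<and> A *v x = l *\<^sub>R b \<and> b \<bullet> x + c \<ge> 0 \<and> l * (b \<bullet> x + c) = 0"

text \<open>Expand the form at \<open>y\<close> around \<open>x\<close>. Stationarity turns the
  cross term into \<open>l\<close> times a difference of constraint values, which is nonnegative by
  feasibility of \<open>y\<close> and complementary slackness at \<open>x\<close>; the remaining
  quadratic term is strictly positive.\<close>

lemma KKT_less:
  assumes "positive_definite A" and "KKT A b c l x" and "b \<bullet> y + c \<ge> 0" and "y \<noteq> x"
  shows "x \<bullet> (A *v x) < y \<bullet> (A *v y)"
proof -
  have "(y - x) \<bullet> (A *v x) = l * (b \<bullet> y + c) - l * (b \<bullet> x + c)"
    using assms(2) by (simp add: KKT_def inner_commute algebra_simps)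
  also have "\<dots> \<ge> 0"
    using assms(2,3) by (auto simp: KKT_def)
  finally have "(y - x) \<bullet> (A *v x) \<ge> 0" .
  moreover have "(y - x) \<bullet> (A *v (y - x)) > 0"
    using assms(1,4) by (simp add: positive_definite_def)
  moreover have "transpose A = A"
    using assms(1) by (simp add: positive_definite_def)
  ultimately show ?thesis
    using quadratic_form_expand[of A y x] by linarith
qed

text \<open>The strict inequality yields minimality and uniqueness at once, so a definite
  description of the minimizer can be evaluated.\<close>

lemma KKT_is_arg_min_unique:
  assumes "positive_definite A" and "KKT A b c l x"
  shows "is_arg_min (\<lambda>y. y \<bullet> (A *v y)) (\<lambda>y. b \<bullet> y + c \<ge> 0) z \<longleftrightarrow> z = x"
proof -
  have "b \<bullet> x + c \<ge> 0"
    using assms(2) by (simp add: KKT_def)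
  then show ?thesis
    using KKT_less[OF assms] unfolding is_arg_min_def by (metis order_less_asym)
qed

text \<open>For \<open>c \<ge> 0\<close> the zero vector with zero multiplier works. Otherwise
  feasibility rules out \<open>b = 0\<close>, and a multiple of \<open>matrix_inv A *v b\<close>
  makes the constraint active.\<close>

lemma KKT_exists:
  assumes "positive_definite A" and "b \<bullet> u + c \<ge> 0"
  obtains l x where "KKT A b c l x"
proof (cases "c \<ge> 0")
  case True
  then have "KKT A b c 0 0"
    by (simp add: KKT_def)
  then show thesis ..
next
  case False
  define w where "w = matrix_inv A *v b"
  have "b \<noteq> 0"
    using assms(2) False by auto
  then have bw: "b \<bullet> w > 0"
    using positive_definite_inner_inverse_pos[OF assms(1)] w_def by blast
  \<comment> \<open>The solution of \<open>b \<bullet> (s *\<^sub>R w) + c = 0\<close>; it also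
    serves as the multiplier.\<close>
  define s where "s = - c / (b \<bullet> w)"
  have "A *v w = b"
    using positive_definite_solve_iff[OF assms(1)] w_def by blast
  moreover have "s \<ge> 0" and "s * (b \<bullet> w) = - c"
    using bw False by (simp_all add: s_def divide_nonpos_pos)
  ultimately have "KKT A b c s (s *\<^sub>R w)"
    by (simp add: KKT_def matrix_vector_mult_scaleR)
  then show thesis ..
qed

section \<open>Gradients and superlevel sets\<close>

lemma continuously_differentiable_GDERIV_grad:
  assumes "continuously_differentiable h"
  shows "GDERIV h x :> grad h x"
proof -
  obtain L where L: "(h has_derivative L) (at x)"
    using assms unfolding continuously_differentiable_def by blast
  have "linear L"
    using L by (rule has_derivative_linear)
  \<comment> \<open>The adjoint at 1 is the Riesz vector of the functional \<open>L\<close>.\<close>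
  then have "L = (\<lambda>y. y \<bullet> adjoint L 1)"
    by (simp add: adjoint_works)
  with L have "GDERIV h x :> adjoint L 1"
    unfolding gderiv_def by simp
  then show ?thesis
    using grad_eqI by metis
qed

lemma GDERIV_directional:
  assumes "GDERIV h x :> D"
  shows "((\<lambda>t. h (x + t *\<^sub>R d)) has_real_derivative D \<bullet> d) (at 0)"
proof -
  have "(h has_derivative (\<lambda>y. y \<bullet> D)) (at (x + 0 *\<^sub>R d))"
    using assms by (simp add: gderiv_def)
  moreover have "((\<lambda>t. x + t *\<^sub>R d) has_derivative (\<lambda>t. t *\<^sub>R d)) (at 0)"
    by (auto intro!: derivative_eq_intros)
  ultimately have "((\<lambda>t. h (x + t *\<^sub>R d)) has_derivative (\<lambda>t. (t *\<^sub>R d) \<bullet> D)) (at 0)"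
    by (rule has_derivative_compose[rotated])
  then show ?thesis
    by (simp add: has_field_derivative_def inner_commute mult.commute[of _ "D \<bullet> d"]
        mult_commute_abs)
qed

text \<open>Moving from \<open>x\<close> a little along \<open>d\<close> makes \<open>h\<close>
  positive; if \<open>D' \<bullet> d\<close> were negative, it would also make \<open>h'\<close>
  negative, against the inclusion.\<close>

lemma superlevel_subset_gradient_half_space:
  assumes "GDERIV h x :> D" and "GDERIV h' x :> D'" and "h x = 0" and "h' x = 0"
    and "{y. h y \<ge> 0} \<subseteq> {y. h' y \<ge> 0}" and "D \<bullet> d > 0"
  shows "D' \<bullet> d \<ge> 0"
proof (rule ccontr)
  assume neg: "\<not> D' \<bullet> d \<ge> 0"
  obtain e where e: "e > 0" "\<And>t. 0 < t \<Longrightarrow> t < e \<Longrightarrow> h (x + t *\<^sub>R d) > 0"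
    using DERIV_pos_inc_right[OF GDERIV_directional[OF assms(1)] assms(6)] assms(3) by auto
  obtain e' where e': "e' > 0" "\<And>t. 0 < t \<Longrightarrow> t < e' \<Longrightarrow> h' (x + t *\<^sub>R d) < 0"
    using DERIV_neg_dec_right[OF GDERIV_directional[OF assms(2)], of d] neg assms(4) by auto
  have "\<exists>t>0. t < e \<and> t < e'"
    using e(1) e'(1) field_lbound_gt_zero by blast
  then obtain t where "t > 0" "t < e" "t < e'" by blast
  then show False
    using e(2)[of t] e'(2)[of t] assms(5) less_imp_le by fastforce
qed

text \<open>Let \<open>p\<close> be the part of \<open>b\<close> orthogonal to \<open>a\<close>. For
  each \<open>s > 0\<close> the direction \<open>s *\<^sub>R a - p\<close> lies in the open
  half-space of \<open>a\<close>, so \<open>p \<bullet> p \<le> s * (b \<bullet> a)\<close>; letting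
  \<open>s\<close> tend to 0 gives \<open>p = 0\<close>.\<close>

lemma half_space_subset_imp_positive_multiple:
  fixes a b :: "'a::real_inner"
  assumes "a \<noteq> 0" and "b \<noteq> 0" and half: "\<And>d. a \<bullet> d > 0 \<Longrightarrow> b \<bullet> d \<ge> 0"
  obtains c where "c > 0" and "b = c *\<^sub>R a"
proof -
  define c where "c = (b \<bullet> a) / (a \<bullet> a)"
  define p where "p = b - c *\<^sub>R a"
  have aa: "a \<bullet> a > 0"
    using assms(1) by simp
  have ap: "a \<bullet> p = 0"
    using assms(1) by (simp add: p_def c_def inner_diff_right inner_commute)
  have bp: "b \<bullet> p = p \<bullet> p"
    using ap by (simp add: p_def inner_diff_left)
  have ba: "b \<bullet> a \<ge> 0"
    using half[OF aa] .
  have "p \<bullet> p \<le> 0 + e" if "e > 0" for e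
  proof -
    \<comment> \<open>Adding 1 keeps the denominator positive when
      \<open>b \<bullet> a = 0\<close>.\<close>
    define s where "s = e / (b \<bullet> a + 1)"
    have s: "s > 0"
      using that ba by (simp add: s_def)
    have "a \<bullet> (s *\<^sub>R a - p) > 0"
      using s aa ap by (simp add: inner_diff_right)
    from half[OF this] have "p \<bullet> p \<le> s * (b \<bullet> a)"
      using bp by (simp add: inner_diff_right)
    also have "\<dots> \<le> s * (b \<bullet> a + 1)"
      using s by simp
    also have "\<dots> = e"
      using ba by (simp add: s_def)
    finally show ?thesis by simp
  qed
  then have "p \<bullet> p \<le> 0"
    by (rule field_le_epsilon)
  then have "p = 0"
    by (metis inner_eq_zero_iff inner_ge_zero order_antisym)
  then have b: "b = c *\<^sub>R a"
    by (simp add: p_def)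
  have "c \<ge> 0"
    using ba by (simp add: c_def)
  moreover have "c \<noteq> 0"
    using b assms(2) by auto
  ultimately have "c > 0" by simp
  then show thesis using b that by blast
qed

section \<open>Barrier functions of the same set at a boundary point\<close>

lemma strict_CBF_alpha_eq_0_iff:
  assumes "strict_CBF f g C h \<alpha>"
  shows "\<alpha> s = 0 \<longleftrightarrow> s = 0"
proof -
  have "strict_mono \<alpha>" and "\<alpha> 0 = 0"
    using assms by (simp_all only: strict_CBF_def ext_class_K_infinity_def)
  then show ?thesis
    using strict_mono_eq by metis
qed

lemma strict_CBF_grad_nonzero:
  assumes "strict_CBF f g C h \<alpha>" and "h x = 0"
  shows "grad h x \<noteq> 0"
proof -
  have "x \<in> C" and "\<alpha> (h x) = 0"
    using assms by (auto simp: strict_CBF_def ext_class_K_infinity_def)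
  then obtain u where "grad h x \<bullet> (f x + g x *v u) > 0"
    using assms(1) unfolding strict_CBF_def by fastforce
  then show ?thesis by auto
qed

lemma strict_CBF_zero_iff_frontier:
  assumes "strict_CBF f g C h \<alpha>"
  shows "h x = 0 \<longleftrightarrow> x \<in> frontier C"
proof -
  have "frontier C = {y. h y = 0}"
    using assms unfolding strict_CBF_def by (elim conjE)
  then show ?thesis by simp
qed

lemma strict_CBF_zero_iff:
  assumes "strict_CBF f g C h \<alpha>" and "strict_CBF f g C h' \<alpha>'"
  shows "h x = 0 \<longleftrightarrow> h' x = 0"
  by (simp only: strict_CBF_zero_iff_frontier[OF assms(1)] strict_CBF_zero_iff_frontier[OF assms(2)])

text \<open>Both superlevel sets equal \<open>C\<close>, so directions in which \<open>h\<close>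
  increases to first order cannot decrease \<open>h'\<close> to first order.\<close>

lemma strict_CBF_grad_positive_multiple:
  assumes "strict_CBF f g C h \<alpha>" and "strict_CBF f g C h' \<alpha>'" and "h x = 0"
  obtains c where "c > 0" and "grad h' x = c *\<^sub>R grad h x"
proof (rule half_space_subset_imp_positive_multiple)
  have h': "h' x = 0"
    using assms strict_CBF_zero_iff by blast
  show "grad h x \<noteq> 0" and "grad h' x \<noteq> 0"
    using strict_CBF_grad_nonzero assms h' by blast+
  show "grad h' x \<bullet> d \<ge> 0" if "grad h x \<bullet> d > 0" for d
  proof (rule superlevel_subset_gradient_half_space)
    show "GDERIV h x :> grad h x" and "GDERIV h' x :> grad h' x"
      using assms continuously_differentiable_GDERIV_grad unfolding strict_CBF_def by blast+
    show "{y. h y \<ge> 0} \<subseteq> {y. h' y \<ge> 0}"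
      using assms unfolding strict_CBF_def by blast
  qed (use assms h' that in auto)
qed

section \<open>The safety filter and its equilibria\<close>

lemma filter_constraint_eq:
  "a \<bullet> (F + B *v \<theta>) + r = (transpose B *v a) \<bullet> \<theta> + (a \<bullet> F + r)"
  for B :: "real^'m^'n"
  by (simp add: inner_add_right dot_lmul_matrix)

lemma safety_filter_eqI:
  assumes "positive_definite (G x)"
    and "KKT (G x) (transpose (g x) *v grad h x) (grad h x \<bullet> F x + \<alpha> (h x)) l \<theta>"
  shows "safety_filter F g G h \<alpha> x = \<theta>"
  using KKT_is_arg_min_unique[OF assms]
  by (simp only: safety_filter_def filter_constraint_eq the_eq_trivial)

lemma safety_filter_KKT:
  assumes "strict_CBF f g C h \<alpha>" and "positive_definite (G x)" and "x \<in> C"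
  obtains l where "KKT (G x) (transpose (g x) *v grad h x)
    (grad h x \<bullet> closed_loop f g k x + \<alpha> (h x)) l (safety_filter (closed_loop f g k) g G h \<alpha> x)"
proof -
  obtain u where "grad h x \<bullet> (f x + g x *v u) + \<alpha> (h x) > 0"
    using assms(1,3) unfolding strict_CBF_def by blast
  \<comment> \<open>An admissible input \<open>u\<close> of the original system becomes the feasible
    correction \<open>u - k x\<close> of the nominal one.\<close>
  moreover have "f x + g x *v u = closed_loop f g k x + g x *v (u - k x)"
    by (simp add: closed_loop_def matrix_vector_mult_diff_distrib)
  ultimately have "(transpose (g x) *v grad h x) \<bullet> (u - k x)
      + (grad h x \<bullet> closed_loop f g k x + \<alpha> (h x)) \<ge> 0"
    by (simp only: filter_constraint_eq less_imp_le)
  then obtain l \<theta> where "KKT (G x) (transpose (g x) *v grad h x)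
      (grad h x \<bullet> closed_loop f g k x + \<alpha> (h x)) l \<theta>"
    using KKT_exists[OF assms(2)] by blast
  then show thesis
    using that safety_filter_eqI[where G = G and x = x, OF assms(2)] by metis
qed

lemma equilibrium_filtered_system_iff:
  assumes cbf: "strict_CBF f g C h \<alpha>" and pd: "positive_definite (G x)"
    and nz: "closed_loop f g k x \<noteq> 0"
  shows "equilibrium_in C (filtered_system f g k G h \<alpha>) x \<longleftrightarrow>
    (\<exists>\<delta><0. h x = 0 \<and> closed_loop f g k x =
       \<delta> *\<^sub>R (g x *v (matrix_inv (G x) *v (transpose (g x) *v grad h x))))"
    (is "?eq \<longleftrightarrow> ?ex")
proof -
  define F where "F = closed_loop f g k"
  define b where "b = transpose (g x) *v grad h x"
  define w where "w = matrix_inv (G x) *v b"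
  define v where "v = safety_filter F g G h \<alpha> x"
  have sys: "filtered_system f g k G h \<alpha> x = F x + g x *v v"
    \<comment> \<open>Instantiating the controller expands only the outer loop and leaves the
      nominal one folded.\<close>
    by (simp add: filtered_system_def closed_loop_def[of _ _ "safety_filter _ _ _ _ _"] F_def v_def)
  have constraint: "b \<bullet> \<theta> + (grad h x \<bullet> F x + \<alpha> (h x)) = grad h x \<bullet> (F x + g x *v \<theta>) + \<alpha> (h x)"
    for \<theta>
    by (simp only: filter_constraint_eq b_def)
  have "?eq \<longleftrightarrow> (\<exists>\<delta><0. h x = 0 \<and> F x = \<delta> *\<^sub>R (g x *v w))"
  proof
    assume ?eq
    then have "x \<in> C" and eq0: "F x + g x *v v = 0"
      by (auto simp: equilibrium_in_def sys)
    obtain l where l: "KKT (G x) b (grad h x \<bullet> F x + \<alpha> (h x)) l v"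
      using safety_filter_KKT[where G = G and x = x, OF cbf pd \<open>x \<in> C\<close>]
      unfolding F_def b_def v_def by blast
    then have "v = matrix_inv (G x) *v (l *\<^sub>R b)"
      using positive_definite_solve_iff[OF pd] KKT_def by blast
    then have v: "v = l *\<^sub>R w"
      by (simp add: w_def matrix_vector_mult_scaleR)
    have "l \<noteq> 0"
      using v eq0 nz by (auto simp: F_def)
    with l have "l > 0" and "\<alpha> (h x) = 0"
      by (auto simp: KKT_def constraint eq0)
    moreover from this have "h x = 0"
      using strict_CBF_alpha_eq_0_iff[OF cbf] by blast
    moreover have "F x = (- l) *\<^sub>R (g x *v w)"
      using eq0 v by (simp add: matrix_vector_mult_scaleR eq_neg_iff_add_eq_0)
    ultimately show "\<exists>\<delta><0. h x = 0 \<and> F x = \<delta> *\<^sub>R (g x *v w)"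
      by (metis neg_less_0_iff_less)
  next
    assume "\<exists>\<delta><0. h x = 0 \<and> F x = \<delta> *\<^sub>R (g x *v w)"
    then obtain \<delta> where \<delta>: "\<delta> < 0" "h x = 0" "F x = \<delta> *\<^sub>R (g x *v w)" by blast
    \<comment> \<open>The candidate filter value \<open>(- \<delta>) *\<^sub>R w\<close> cancels the
      nominal field. With multiplier \<open>- \<delta>\<close> it satisfies KKT, since the
      constraint value is then \<open>\<alpha> (h x) = 0\<close>.\<close>
    have eq0: "F x + g x *v ((- \<delta>) *\<^sub>R w) = 0"
      by (simp only: matrix_vector_mult_scaleR \<delta>(3)) simp
    have "G x *v w = b"
      using positive_definite_solve_iff[OF pd] w_def by blast
    then have "KKT (G x) b (grad h x \<bullet> F x + \<alpha> (h x)) (- \<delta>) ((- \<delta>) *\<^sub>R w)"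
      unfolding KKT_def constraint eq0
      using \<delta>(1,2) strict_CBF_alpha_eq_0_iff[OF cbf, of "h x"]
      by (simp only: matrix_vector_mult_scaleR) simp
    then have "v = (- \<delta>) *\<^sub>R w"
      unfolding v_def b_def by (rule safety_filter_eqI[where G = G and x = x, OF pd])
    moreover have "x \<in> C"
      using cbf \<delta>(2) unfolding strict_CBF_def by auto
    ultimately show ?eq
      using eq0 by (simp only: equilibrium_in_def sys)
  qed
  then show ?thesis
    by (simp only: F_def w_def b_def)
qed

lemma equilibrium_filtered_system_transfer:
  assumes cbf: "strict_CBF f g C h \<alpha>" and cbf': "strict_CBF f g C h' \<alpha>'"
    and pd: "positive_definite (G x)" and nz: "closed_loop f g k x \<noteq> 0"
    and eq: "equilibrium_in C (filtered_system f g k G h \<alpha>) x"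
  shows "equilibrium_in C (filtered_system f g k G h' \<alpha>') x"
proof -
  obtain \<delta> where \<delta>: "\<delta> < 0" "h x = 0" and F: "closed_loop f g k x =
      \<delta> *\<^sub>R (g x *v (matrix_inv (G x) *v (transpose (g x) *v grad h x)))"
    using eq equilibrium_filtered_system_iff[where G = G and x = x, OF cbf pd nz] by blast
  obtain c where c: "c > 0" "grad h' x = c *\<^sub>R grad h x"
    using strict_CBF_grad_positive_multiple[OF cbf cbf' \<delta>(2)] .
  \<comment> \<open>Dividing by \<open>c\<close> compensates for the rescaled gradient.\<close>
  have "\<delta> / c < 0"
    using \<delta>(1) c(1) by (simp add: divide_neg_pos)
  moreover have "h' x = 0"
    using strict_CBF_zero_iff[OF cbf cbf'] \<delta>(2) by blast
  moreover have "closed_loop f g k x =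
      (\<delta> / c) *\<^sub>R (g x *v (matrix_inv (G x) *v (transpose (g x) *v grad h' x)))"
    unfolding F c(2) matrix_vector_mult_scaleR using c(1) by simp
  ultimately show ?thesis
    using equilibrium_filtered_system_iff[where G = G and x = x, OF cbf' pd nz] by blast
qed

theorem lemma4p1:
  fixes f :: "real^'n \<Rightarrow> real^'n"
    and g :: "real^'n \<Rightarrow> real^'m^'n"
    and k :: "real^'n \<Rightarrow> real^'m"
    and G :: "real^'n \<Rightarrow> real^'m^'m"
    and h :: "real^'n \<Rightarrow> real"
    and \<alpha> :: "real \<Rightarrow> real"
    and C :: "(real^'n) set"
    and x\<^sub>0 :: "real^'n"
  assumes "locally_lipschitz f" and "locally_lipschitz g" and "locally_lipschitz k"
    and "\<forall>x. equilibrium_in UNIV (closed_loop f g k) x \<longleftrightarrow> x = 0"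
    and "origin_GAS (closed_loop f g k)"
    and "continuously_differentiable G" and "\<forall>x. positive_definite (G x)"
    and "strict_CBF f g C h \<alpha>"
    and "h 0 > 0"
    and "closed_loop f g k x\<^sub>0 \<noteq> 0"
  shows "(equilibrium_in C (filtered_system f g k G h \<alpha>) x\<^sub>0 \<longleftrightarrow>
            (\<exists>\<delta><0. h x\<^sub>0 = 0 \<and>
               closed_loop f g k x\<^sub>0 =
                 \<delta> *\<^sub>R (g x\<^sub>0 *v (matrix_inv (G x\<^sub>0) *v (transpose (g x\<^sub>0) *v grad h x\<^sub>0)))))
         \<and> (\<forall>h' \<alpha>'. strict_CBF f g C h' \<alpha>' \<longrightarrow>
              (equilibrium_in C (filtered_system f g k G h \<alpha>) x\<^sub>0 \<longleftrightarrow>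
               equilibrium_in C (filtered_system f g k G h' \<alpha>') x\<^sub>0))"
proof -
  have pd: "positive_definite (G x\<^sub>0)"
    using assms(7) by blast
  \<comment> \<open>The transfer is used twice, with the two barrier functions exchanged.\<close>
  show ?thesis
    using equilibrium_filtered_system_iff[where G = G and x = x\<^sub>0, OF assms(8) pd assms(10)]
      equilibrium_filtered_system_transfer[where G = G and x = x\<^sub>0, OF _ _ pd assms(10)] assms(8)
    by blast
qed

end
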